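(* Let $T$ be a finite set of subgraph types and, for each $n$, let $G_w$ be a random graph of size $n$ generated by the weighted subgraph generated model $\mathrm{wSUGM}(n,T,p)$ with probabilities $p(\cdot,\cdot)$, and let $A_w$ be its adjacency matrix. Denote by $\Delta_w := \|\mathbb{E}[A_w]\|_{\infty}$ the maximum expected degree and by $M := \max_{t\in T} m_t$ the maximum subgraph size. Let $\epsilon>0$ and suppose that for $n$ sufficiently large $$\Delta_w > \tfrac{4}{9}\ln(2n/\epsilon).$$ Then, for $n$ sufficiently large, with probability at least $1-\epsilon$, $$\|A_w-\mathbb{E}[A_w]\|_2 \le \sqrt{4M^2\,\Delta_w\,\ln(2n/\epsilon)}.$$
   Context: Subgraph types. $T$ is a finite nonempty set of types, fixed independently of $n$. Each type $t\in T$ is a fixed nonempty (i.e. having at least one edge) undirected simple graph on $m_t$ nodes. For $n\ge m_t$, $\mathfrak{S}(n,m_t)$ denotes the set of all ordered lists $L=[v_1,\dots,v_{m_t}]$ of $m_t$ distinct nodes of $\{1,\dots,n\}$, and $g_t(L)$ is the copy of the type-$t$ graph placed on the nodes of $L$ in the given order (its $a$-th node is identified with $v_a$). $A(t,L)\in\{0,1\}^{n\times n}$ is the symmetric adjacency matrix of $g_t(L)$: $A(t,L)_{ij}=A(t,L)_{ji}=1$ iff $i,j\in L$ and $(i,j)$ is an edge of $g_t(L)$. Weighted model. For each $n$, probabilities $p(t,L)\in[0,1]$ are given for all $t\in T$, $L\in\mathfrak{S}(n,m_t)$ (they may depend on $n$). Let $x(t,L)\sim\mathrm{Bernoulli}(p(t,L))$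 be mutually independent (each subgraph $g_t(L)$ is formed independently with probability $p(t,L)$). The adjacency matrix of $\mathrm{wSUGM}(n,T,p)$ is $A_w=\sum_{t\in T}\sum_{L\in\mathfrak{S}(n,m_t)} x(t,L)A(t,L)$, i.e. $(A_w)_{ij}$ is the total number of formed subgraphs containing edge $(i,j)$. Norms: $\|\cdot\|_2$ is the spectral norm and $\|\cdot\|_\infty$ the maximum absolute row sum norm of a matrix. *)

theory Defs
  imports
    "HOL-Probability.Probability"
    "Graph_Theory.Pair_Digraph"
    "Jordan_Normal_Form.Matrix"
begin

text \<open>
  An undirected simple graph is a \<^locale>\<open>pair_graph\<close>: every edge \<open>{a, b}\<close> is represented by the
  two arcs \<open>(a, b)\<close> and \<open>(b, a)\<close>. The vertices of a type are numbered from \<open>0\<close>, so that they are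
  the positions of a list of length \<open>m\<^sub>t\<close>. Matrix indices start from \<open>0\<close>, hence the \<open>n\<close> nodes of
  the random graph are \<open>0, \<dots>, n - 1\<close> instead of \<open>1, \<dots>, n\<close>.
\<close>

definition type_size :: "nat pair_pre_digraph \<Rightarrow> nat" where
  "type_size t = card (pverts t)"

definition subgraph_type :: "nat pair_pre_digraph \<Rightarrow> bool" where
  "subgraph_type t \<longleftrightarrow> pair_graph t \<and> pverts t = {0..<type_size t} \<and> parcs t \<noteq> {}"

definition placements :: "nat \<Rightarrow> nat \<Rightarrow> nat list set" where
  "placements n m = {L. length L = m \<and> distinct L \<and> set L \<subseteq> {0..<n}}"

definition subgraph_copy :: "nat pair_pre_digraph \<Rightarrow> nat list \<Rightarrow> nat pair_pre_digraph" where
  "subgraph_copy t L = \<lparr>pverts = set L, parcs = (\<lambda>(a, b). (L ! a, L ! b)) ` parcs t\<rparr>"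

definition copy_adj :: "nat \<Rightarrow> nat pair_pre_digraph \<Rightarrow> nat list \<Rightarrow> real mat" where
  "copy_adj n t L = Matrix.mat n n (\<lambda>(i, j). of_bool ((i, j) \<in> parcs (subgraph_copy t L)))"

text \<open>\<open>X t L \<omega>\<close> states that the copy of \<open>t\<close> placed on \<open>L\<close> is formed in the outcome \<open>\<omega>\<close>.\<close>

locale wSUGM = prob_space M
  for M :: "'a measure" +
  fixes n :: nat
    and T :: "nat pair_pre_digraph set"
    and p :: "nat pair_pre_digraph \<Rightarrow> nat list \<Rightarrow> real"
    and X :: "nat pair_pre_digraph \<Rightarrow> nat list \<Rightarrow> 'a \<Rightarrow> bool"
  assumes prob_range: "\<And>t L. t \<in> T \<Longrightarrow> L \<in> placements n (type_size t) \<Longrightarrow> p t L \<in> {0..1}"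
    and bernoulli: "\<And>t L. t \<in> T \<Longrightarrow> L \<in> placements n (type_size t) \<Longrightarrow>
          distr M (count_space UNIV) (X t L) = measure_pmf (bernoulli_pmf (p t L))"
    and indep: "indep_vars (\<lambda>_. count_space UNIV) (\<lambda>(t, L). X t L)
          (SIGMA t:T. placements n (type_size t))"

definition wSUGM_adj ::
  "nat \<Rightarrow> nat pair_pre_digraph set \<Rightarrow> (nat pair_pre_digraph \<Rightarrow> nat list \<Rightarrow> 'a \<Rightarrow> bool) \<Rightarrow> 'a \<Rightarrow> real mat"
  where
  "wSUGM_adj n T X \<omega> = Matrix.mat n n (\<lambda>(i, j).
     \<Sum>t\<in>T. \<Sum>L\<in>placements n (type_size t). of_bool (X t L \<omega>) * copy_adj n t L $$ (i, j))"

definition expected_mat :: "'a measure \<Rightarrow> nat \<Rightarrow> ('a \<Rightarrow> real mat) \<Rightarrow> real mat" where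
  "expected_mat M n A = Matrix.mat n n (\<lambda>(i, j). \<integral>\<omega>. A \<omega> $$ (i, j) \<partial>M)"

definition mat_norm_inf :: "real mat \<Rightarrow> real" where
  "mat_norm_inf A = Max ((\<lambda>i. \<Sum>j<dim_col A. \<bar>A $$ (i, j)\<bar>) ` {..<dim_row A})"

definition vec_norm2 :: "real Matrix.vec \<Rightarrow> real" where
  "vec_norm2 v = sqrt (scalar_prod v v)"

definition spectral_norm :: "real mat \<Rightarrow> real" where
  "spectral_norm A =
     (SUP v\<in>{v \<in> carrier_vec (dim_col A). vec_norm2 v = 1}. vec_norm2 (A *\<^sub>v v))"

end

theory Submission
  imports Defs
begin

text \<open>
  The proof is a moment method. Write \<open>S = \<Sum>\<^sub>i y\<^sub>i B\<^sub>i\<close> for the centred adjacency matrix, with one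
  summand per potential copy. Since the entries of the \<open>B\<^sub>i\<close> are nonnegative and
  \<open>\<bar>E[y\<^sub>i\<^sup>k]\<bar>\<close> is at most \<open>p\<^sub>i\<close> for \<open>k \<ge> 2\<close> and vanishes for \<open>k = 1\<close>, only words in which every letter
  occurs at least twice contribute to \<open>E[tr S\<^sup>m]\<close>. Reading such a word as a walk, a new letter
  contributes at most the maximum expected degree \<open>\<Delta>\<close>, and a repeated one at most the
  maximum row sum \<open>R\<close> of the \<open>B\<^sub>i\<close>. Hence \<open>E[tr S\<^sup>m]\<close> is at most \<open>n R\<^sup>m\<close> times the \<open>m\<close>-th central
  moment of a Poisson variable of mean \<open>\<Delta> / R\<close>, and Markov's inequality for
  \<open>tr (cosh (\<theta> S))\<close> yields a Bennett inequality for the spectral norm with dimension factor \<open>2 n\<close>.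
  The nonnegativity of the \<open>B\<^sub>i\<close> thus replaces the Golden--Thompson or Lieb trace inequalities of the
  general matrix Bernstein inequality.
\<close>

section \<open>Powers of symmetric matrices\<close>

lemma pow_mat_add:
  assumes "A \<in> carrier_mat n n"
  shows "A ^\<^sub>m (j + k) = A ^\<^sub>m j * A ^\<^sub>m k"
proof (induction k)
  case 0
  then show ?case using assms by (auto simp: right_mult_one_mat[of _ n])
next
  case (Suc k)
  then show ?case using assms by (auto simp: assoc_mult_mat[of _ n n _ n _ n])
qed

lemma transpose_pow_mat:
  fixes A :: "'a :: comm_semiring_1 mat"
  assumes "A \<in> carrier_mat n n"
  shows "transpose_mat (A ^\<^sub>m k) = transpose_mat A ^\<^sub>m k"
proof (induction k)
  case 0
  then show ?case using assms by simp
next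
  case (Suc k)
  have "transpose_mat (A ^\<^sub>m Suc k) = transpose_mat A * transpose_mat A ^\<^sub>m k"
    using transpose_mult[OF pow_carrier_mat[OF assms] assms] Suc by simp
  also have "\<dots> = transpose_mat A ^\<^sub>m (1 + k)"
    using assms by (subst pow_mat_add[of _ n]) (auto simp: left_mult_one_mat[of _ n])
  finally show ?case by simp
qed

lemma scalar_prod_self:
  fixes v :: "real Matrix.vec"
  assumes "v \<in> carrier_vec n"
  shows "scalar_prod v v = (\<Sum>i<n. (vec_index v i)\<^sup>2)"
  using assms by (auto simp: scalar_prod_def power2_eq_square atLeast0LessThan)

lemma scalar_prod_Cauchy_Schwarz:
  fixes v w :: "real Matrix.vec"
  assumes "v \<in> carrier_vec n" "w \<in> carrier_vec n"
  shows "(scalar_prod v w)\<^sup>2 \<le> scalar_prod v v * scalar_prod w w"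
proof -
  have "scalar_prod v w = (\<Sum>i<n. vec_index v i * vec_index w i)"
    using assms by (auto simp: scalar_prod_def atLeast0LessThan)
  then show ?thesis
    using Cauchy_Schwarz_ineq_sum[of "vec_index v" "vec_index w" "{..<n}"] assms
    by (simp add: scalar_prod_self)
qed

text \<open>Cauchy-Schwarz applied to each row. The loss against the operator norm is harmless here:
  for a power \<open>A ^\<^sub>m k\<close> of a symmetric \<open>A\<close> the factor is exactly the
  trace of \<open>A ^\<^sub>m (2 * k)\<close>.\<close>

lemma mult_mat_vec_norm_le_frobenius:
  fixes A :: "real mat"
  assumes A: "A \<in> carrier_mat n n" and v: "v \<in> carrier_vec n"
  shows "scalar_prod (A *\<^sub>v v) (A *\<^sub>v v)
    \<le> (\<Sum>i<n. \<Sum>j<n. (A $$ (i, j))\<^sup>2) * scalar_prod v v"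
proof -
  have "scalar_prod (A *\<^sub>v v) (A *\<^sub>v v) = (\<Sum>i<n. (scalar_prod (row A i) v)\<^sup>2)"
    using A v by (subst scalar_prod_self[of _ n]) auto
  also have "\<dots> \<le> (\<Sum>i<n. scalar_prod (row A i) (row A i) * scalar_prod v v)"
    using A v by (intro sum_mono scalar_prod_Cauchy_Schwarz[of _ n]) auto
  also have "\<dots> = (\<Sum>i<n. \<Sum>j<n. (A $$ (i, j))\<^sup>2) * scalar_prod v v"
    using A by (subst sum_distrib_right, intro sum.cong) (auto simp: scalar_prod_self[of _ n])
  finally show ?thesis .
qed

lemma diag_pow_mat_symmetric:
  fixes A :: "real mat"
  assumes A: "A \<in> carrier_mat n n" and sym: "transpose_mat A = A" and i: "i < n"
  shows "(A ^\<^sub>m (2 * k)) $$ (i, i) = (\<Sum>j<n. ((A ^\<^sub>m k) $$ (i, j))\<^sup>2)"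
proof -
  have T: "transpose_mat (A ^\<^sub>m k) = A ^\<^sub>m k"
    using transpose_pow_mat[OF A] sym by simp
  have "(A ^\<^sub>m k) $$ (j, i) = (A ^\<^sub>m k) $$ (i, j)" if "j < n" for j
  proof -
    have "transpose_mat (A ^\<^sub>m k) $$ (i, j) = (A ^\<^sub>m k) $$ (j, i)"
      by (rule index_transpose_mat) (use A that i in auto)
    then show ?thesis unfolding T by simp
  qed
  moreover have "A ^\<^sub>m (2 * k) = A ^\<^sub>m k * A ^\<^sub>m k"
    using pow_mat_add[OF A] by (simp add: mult_2)
  ultimately show ?thesis
    using A i by (auto simp: scalar_prod_def power2_eq_square atLeast0LessThan)
qed

text \<open>
  The sequence \<open>a\<^sub>k = \<parallel>A\<^sup>k v\<parallel>\<^sup>2\<close> is log-convex with \<open>a\<^sub>0 = 1\<close>, so \<open>a\<^sub>1\<^sup>k \<le> a\<^sub>k\<close>; this avoids the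
  spectral theorem.
\<close>

lemma norm_power_le_trace:
  fixes A :: "real mat"
  assumes A: "A \<in> carrier_mat n n" and sym: "transpose_mat A = A"
    and v: "v \<in> carrier_vec n" and unit: "vec_norm2 v = 1"
  shows "vec_norm2 (A *\<^sub>v v) ^ (2 * k) \<le> (\<Sum>i<n. (A ^\<^sub>m (2 * k)) $$ (i, i))"
proof -
  define w where "w k = A ^\<^sub>m k *\<^sub>v v" for k
  define a where "a k = scalar_prod (w k) (w k)" for k
  have w_carrier: "w k \<in> carrier_vec n" for k
    unfolding w_def using A v by (intro mult_mat_vec_carrier) auto
  have w_Suc: "w (Suc k) = A *\<^sub>v w k" for k
  proof -
    have "A ^\<^sub>m Suc k = A * A ^\<^sub>m k"
      using pow_mat_add[OF A, of 1 k] A by (simp add: left_mult_one_mat[of _ n])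
    then show ?thesis
      unfolding w_def using A v by (simp add: assoc_mult_mat_vec[of _ n n _ n])
  qed
  have a_nonneg: "0 \<le> a k" for k
    unfolding a_def scalar_prod_self[OF w_carrier] by (intro sum_nonneg) auto
  have vv: "scalar_prod v v = 1"
    using unit by (simp add: vec_norm2_def real_sqrt_eq_1_iff)
  have a_0: "a 0 = 1"
    using A v vv by (simp add: a_def w_def)
  have log_convex: "(a (Suc k))\<^sup>2 \<le> a k * a (Suc (Suc k))" for k
  proof -
    \<comment> \<open>Symmetry moves one factor \<open>A\<close> across the inner product, which
      turns \<open>a (Suc k)\<close> into the inner product of \<open>w (Suc (Suc k))\<close> and
      \<open>w k\<close>; Cauchy-Schwarz then gives log-convexity.\<close>
    have "a (Suc k) = scalar_prod (w (Suc k)) (A *\<^sub>v w k)"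
      by (simp add: a_def w_Suc)
    also have "\<dots> = scalar_prod (transpose_mat A *\<^sub>v w (Suc k)) (w k)"
      by (rule transpose_vec_mult_scalar[OF A w_carrier w_carrier, symmetric])
    also have "\<dots> = scalar_prod (w (Suc (Suc k))) (w k)"
      by (simp add: sym w_Suc)
    finally show ?thesis
      using scalar_prod_Cauchy_Schwarz[OF w_carrier w_carrier, of "Suc (Suc k)" k]
      by (simp add: a_def mult.commute)
  qed
  \<comment> \<open>Log-convexity makes the ratios of consecutive terms increase from
    \<open>a 1 / a 0 = a 1\<close>. The multiplied-out form also covers vanishing terms.\<close>
  have step: "a 1 * a k \<le> a (Suc k)" for k
  proof (induction k)
    case 0
    then show ?case by (simp add: a_0)
  next
    case (Suc k)
    show ?case
    proof (cases "a (Suc k) = 0")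
      case True
      then show ?thesis using a_nonneg by simp
    next
      case False
      then have "a k \<noteq> 0" using log_convex[of k] by auto
      then have pos: "0 < a k" using a_nonneg[of k] by simp
      have "a k * (a 1 * a (Suc k)) = (a 1 * a k) * a (Suc k)" by simp
      also have "\<dots> \<le> a (Suc k) * a (Suc k)"
        using Suc a_nonneg by (intro mult_right_mono)
      also have "\<dots> \<le> a k * a (Suc (Suc k))"
        using log_convex[of k] by (simp add: power2_eq_square)
      finally show ?thesis using pos by simp
    qed
  qed
  have pow: "a 1 ^ k \<le> a k" for k
  proof (induction k)
    case 0
    then show ?case by (simp add: a_0)
  next
    case (Suc k)
    then have "a 1 ^ Suc k \<le> a 1 * a k"
      using a_nonneg by (simp add: mult_left_mono)
    then show ?case using step[of k] by linarith
  qed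
  have "vec_norm2 (A *\<^sub>v v) ^ (2 * k) = a 1 ^ k"
    using a_nonneg[of 1] A v
    by (simp add: vec_norm2_def power_mult a_def w_def left_mult_one_mat[of _ n])
  also have "\<dots> \<le> a k" by (rule pow)
  also have "\<dots> \<le> (\<Sum>i<n. \<Sum>j<n. ((A ^\<^sub>m k) $$ (i, j))\<^sup>2) * scalar_prod v v"
    unfolding a_def w_def using A v by (intro mult_mat_vec_norm_le_frobenius) auto
  also have "\<dots> = (\<Sum>i<n. (A ^\<^sub>m (2 * k)) $$ (i, i))"
    using diag_pow_mat_symmetric[OF A sym] vv by simp
  finally show ?thesis .
qed

section \<open>Weighted counts of words without single letters\<close>

text \<open>
  The total weight of the ways to extend a word by \<open>m\<close> letters so that in the end no letter occurs
  exactly once, when \<open>s\<close> letters have occurred once and \<open>f\<close> letters at least twice so far. A new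
  letter has weight \<open>D\<close>, a repeated one weight \<open>R\<close>.
\<close>

fun collision_moment :: "real \<Rightarrow> real \<Rightarrow> nat \<Rightarrow> nat \<Rightarrow> nat \<Rightarrow> real" where
  "collision_moment R D 0 s f = of_bool (s = 0)"
| "collision_moment R D (Suc m) s f = D * collision_moment R D m (Suc s) f
    + real s * R * collision_moment R D m (s - 1) (Suc f) + real f * R * collision_moment R D m s f"

lemma collision_moment_nonneg: "0 \<le> R \<Longrightarrow> 0 \<le> D \<Longrightarrow> 0 \<le> collision_moment R D m s f"
  by (induction R D m s f rule: collision_moment.induct) auto

text \<open>
  The right-hand side is the full exponential generating function; its derivative obeys the
  recursion of \<^const>\<open>collision_moment\<close>.
\<close>

lemma collision_moment_egf_le:
  assumes R: "0 < R" and D: "0 \<le> D" and "0 \<le> \<theta>"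
  shows "(\<Sum>m<K. \<theta> ^ m / fact m * collision_moment R D m s f)
    \<le> exp (D / R * (exp (R * \<theta>) - 1 - R * \<theta>)) * (exp (R * \<theta>) - 1) ^ s * exp (R * \<theta>) ^ f"
  using \<open>0 \<le> \<theta>\<close>
proof (induction K arbitrary: s f \<theta>)
  case 0
  then show ?case using R by simp
next
  case (Suc K)
  define G where "G s f \<theta> = exp (D / R * (exp (R * \<theta>) - 1 - R * \<theta>)) * (exp (R * \<theta>) - 1) ^ s
    * exp (R * \<theta>) ^ f" for s f and \<theta> :: real
  define L where "L K s f \<theta> = (\<Sum>m<K. \<theta> ^ m / fact m * collision_moment R D m s f)"
    for K s f and \<theta> :: real
  have IH: "L K s f \<theta> \<le> G s f \<theta>" if "0 \<le> \<theta>" for s f \<theta>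
    using Suc.IH[OF that] by (simp add: L_def G_def)
  \<comment> \<open>The three factors of \<open>G\<close> yield the three summands by the product
    rule. For \<open>s = 0\<close> the truncated \<open>s - 1\<close> is harmless because of the
    factor \<open>real s\<close>.\<close>
  have G': "(G s f has_real_derivative D * G (Suc s) f x + real s * R * G (s - 1) (Suc f) x
    + real f * R * G s f x) (at x)" for x
  proof -
    have exponent: "((\<lambda>x. exp (D / R * (exp (R * x) - 1 - R * x))) has_real_derivative
        D * (exp (R * x) - 1) * exp (D / R * (exp (R * x) - 1 - R * x))) (at x)"
      using R by (auto intro!: derivative_eq_intros simp: field_simps)
    have base: "((\<lambda>x. (exp (R * x) - 1) ^ s) has_real_derivative
        real s * (exp (R * x) - 1) ^ (s - 1) * (R * exp (R * x))) (at x)"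
      by (auto intro!: derivative_eq_intros)
    have tilt: "((\<lambda>x. exp (R * x) ^ f) has_real_derivative real f * R * exp (R * x) ^ f) (at x)"
      unfolding exp_of_nat_mult[symmetric] by (auto intro!: derivative_eq_intros)
    show ?thesis
      unfolding G_def
      by (rule DERIV_cong[OF DERIV_mult[OF DERIV_mult[OF exponent base] tilt]])
         (simp add: algebra_simps)
  qed
  \<comment> \<open>Differentiation shortens the partial sum from \<open>Suc K\<close> to
    \<open>K\<close> terms, so its derivative is governed by the induction hypothesis.\<close>
  have L': "(L (Suc K) s f has_real_derivative D * L K (Suc s) f x
    + real s * R * L K (s - 1) (Suc f) x + real f * R * L K s f x) (at x)" for x
  proof -
    have "L (Suc K) s f = (\<lambda>\<theta>. of_bool (s = 0)
        + (\<Sum>m<K. \<theta> ^ Suc m / fact (Suc m) * collision_moment R D (Suc m) s f))"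
      unfolding L_def by (subst sum.lessThan_Suc_shift) simp
    moreover have "((\<lambda>\<theta>. \<theta> ^ Suc m / fact (Suc m) * c) has_real_derivative x ^ m / fact m * c) (at x)"
      for m c
      by (auto intro!: derivative_eq_intros simp: field_simps simp del: fact_Suc power_Suc)
         (simp add: field_simps)
    ultimately have "(L (Suc K) s f has_real_derivative
        0 + (\<Sum>m<K. x ^ m / fact m * collision_moment R D (Suc m) s f)) (at x)"
      by (simp only:) (intro DERIV_add DERIV_const DERIV_sum)
    also have "0 + (\<Sum>m<K. x ^ m / fact m * collision_moment R D (Suc m) s f)
      = D * L K (Suc s) f x + real s * R * L K (s - 1) (Suc f) x + real f * R * L K s f x"
      by (simp add: L_def sum_distrib_left sum.distrib algebra_simps)
    finally show ?thesis .
  qed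
  \<comment> \<open>Comparison of derivatives: the difference starts at 0 and is nondecreasing,
    since each summand of \<open>L'\<close> is dominated by the matching summand of
    \<open>G'\<close>.\<close>
  have "G s f 0 - L (Suc K) s f 0 \<le> G s f \<theta> - L (Suc K) s f \<theta>"
  proof (rule DERIV_nonneg_imp_nondecreasing[OF Suc.prems])
    fix x :: real
    assume x: "0 \<le> x" "x \<le> \<theta>"
    have le: "D * L K (Suc s) f x + real s * R * L K (s - 1) (Suc f) x + real f * R * L K s f x
        \<le> D * G (Suc s) f x + real s * R * G (s - 1) (Suc f) x + real f * R * G s f x"
      using R D IH[OF x(1)] by (intro add_mono mult_left_mono) auto
    show "\<exists>y. ((\<lambda>x. G s f x - L (Suc K) s f x) has_real_derivative y) (at x) \<and> 0 \<le> y"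
      by (rule exI, rule conjI, rule DERIV_diff[OF G' L']) (use le in simp)
  qed
  moreover have "L (Suc K) s f 0 = G s f 0"
  proof -
    have "L (Suc K) s f 0 = of_bool (s = 0)"
      unfolding L_def by (subst sum.lessThan_Suc_shift) simp
    then show ?thesis by (simp add: G_def power_0_left)
  qed
  ultimately show ?case by (simp add: L_def G_def)
qed

section \<open>Random series of entrywise nonnegative matrices\<close>

text \<open>The letters are the indices in \<open>I\<close>. \<open>R\<close> bounds the cost of
  repeating a given letter and \<open>D\<close> the total mean cost of all letters. Column sums
  occur because walks are read backwards from their end vertex.\<close>

locale random_matrix_series = prob_space M
  for M :: "'a measure" +
  fixes n :: nat
    and I :: "'i set"
    and y :: "'i \<Rightarrow> 'a \<Rightarrow> real"
    and q :: "'i \<Rightarrow> real"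
    and B :: "'i \<Rightarrow> real mat"
    and R D :: real
  assumes finite_I: "finite I"
    and indep: "indep_vars (\<lambda>_. borel) y I"
    and bounded: "\<And>i \<omega>. i \<in> I \<Longrightarrow> \<omega> \<in> space M \<Longrightarrow> \<bar>y i \<omega>\<bar> \<le> 1"
    and centered: "\<And>i. i \<in> I \<Longrightarrow> expectation (y i) = 0"
    and second_moment: "\<And>i. i \<in> I \<Longrightarrow> expectation (\<lambda>\<omega>. (y i \<omega>)\<^sup>2) \<le> q i"
    and B_nonneg: "\<And>i u v. i \<in> I \<Longrightarrow> u < n \<Longrightarrow> v < n \<Longrightarrow> 0 \<le> B i $$ (u, v)"
    and B_sym: "\<And>i u v. i \<in> I \<Longrightarrow> u < n \<Longrightarrow> v < n \<Longrightarrow> B i $$ (u, v) = B i $$ (v, u)"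
    and R_pos: "0 < R"
    and D_nonneg: "0 \<le> D"
    and B_col_sum: "\<And>i v. i \<in> I \<Longrightarrow> v < n \<Longrightarrow> (\<Sum>u<n. B i $$ (u, v)) \<le> R"
    and mean_col_sum: "\<And>v. v < n \<Longrightarrow> (\<Sum>i\<in>I. q i * (\<Sum>u<n. B i $$ (u, v))) \<le> D"
begin

definition S :: "'a \<Rightarrow> real mat" where
  "S \<omega> = Matrix.mat n n (\<lambda>(u, v). \<Sum>i\<in>I. y i \<omega> * B i $$ (u, v))"

lemma S_carrier [simp]: "S \<omega> \<in> carrier_mat n n"
  by (simp add: S_def)

lemma S_transpose: "transpose_mat (S \<omega>) = S \<omega>"
  unfolding S_def using B_sym by (intro eq_matI) (auto intro!: sum.cong)

section \<open>Mixed moments of the coefficients\<close>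

lemma rv [measurable]: "i \<in> I \<Longrightarrow> random_variable borel (y i)"
  using indep by (auto simp: indep_vars_def)

lemma integrable_power: "i \<in> I \<Longrightarrow> integrable M (\<lambda>\<omega>. y i \<omega> ^ k)"
  using bounded
  by (intro integrable_const_bound[of _ 1] AE_I2) (auto simp: power_abs power_le_one)

lemma q_nonneg: "i \<in> I \<Longrightarrow> 0 \<le> q i"
  by (rule order_trans[OF _ second_moment]) simp

text \<open>As \<open>y i\<close> is bounded by 1, every power from the second on is dominated by
  the square. A letter is therefore paid for once, however often it is repeated.\<close>

lemma expectation_power_le:
  assumes i: "i \<in> I"
  shows "\<bar>expectation (\<lambda>\<omega>. y i \<omega> ^ k)\<bar> \<le> (if k = 0 then 1 else if k = 1 then 0 else q i)"
proof -
  have "\<bar>expectation (\<lambda>\<omega>. y i \<omega> ^ k)\<bar> \<le> q i" if k: "2 \<le> k"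
  proof -
    have "\<bar>expectation (\<lambda>\<omega>. y i \<omega> ^ k)\<bar> \<le> expectation (\<lambda>\<omega>. \<bar>y i \<omega> ^ k\<bar>)"
      using integral_abs_bound[of M "\<lambda>\<omega>. y i \<omega> ^ k"] by simp
    also have "\<dots> \<le> expectation (\<lambda>\<omega>. (y i \<omega>)\<^sup>2)"
    proof (rule integral_mono)
      show "integrable M (\<lambda>\<omega>. \<bar>y i \<omega> ^ k\<bar>)" "integrable M (\<lambda>\<omega>. (y i \<omega>)\<^sup>2)"
        using integrable_power[OF i] by auto
      fix \<omega> assume "\<omega> \<in> space M"
      then have "\<bar>y i \<omega>\<bar> ^ k \<le> \<bar>y i \<omega>\<bar> ^ 2"
        using bounded[OF i] k by (intro power_decreasing) auto
      then show "\<bar>y i \<omega> ^ k\<bar> \<le> (y i \<omega>)\<^sup>2" by (simp add: power_abs)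
    qed
    also have "\<dots> \<le> q i" by (rule second_moment[OF i])
    finally show ?thesis .
  qed
  moreover have "k = 0 \<or> k = 1 \<or> 2 \<le> k" by linarith
  ultimately show ?thesis
    using centered[OF i] by (auto simp: prob_space)
qed

text \<open>Here \<open>k\<close> records the multiplicity of each letter in a word. Independence
  factorises the expectation, and a single letter of multiplicity one annihilates it by
  centering.\<close>

lemma monomial_integrable: "integrable M (\<lambda>\<omega>. \<Prod>i\<in>I. y i \<omega> ^ k i)"
  and monomial_expectation_le: "\<bar>expectation (\<lambda>\<omega>. \<Prod>i\<in>I. y i \<omega> ^ k i)\<bar>
    \<le> (\<Prod>i\<in>{i\<in>I. 1 \<le> k i}. q i) * of_bool ({i\<in>I. k i = 1} = {})"
proof -
  have indep': "indep_vars (\<lambda>_. borel) (\<lambda>i \<omega>. y i \<omega> ^ k i) I"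
    using indep_vars_compose2[OF indep, of "\<lambda>i x. x ^ k i" "\<lambda>_. borel"] by simp
  show "integrable M (\<lambda>\<omega>. \<Prod>i\<in>I. y i \<omega> ^ k i)"
    using finite_I indep' integrable_power by (intro indep_vars_integrable) auto
  have "\<bar>expectation (\<lambda>\<omega>. \<Prod>i\<in>I. y i \<omega> ^ k i)\<bar> = (\<Prod>i\<in>I. \<bar>expectation (\<lambda>\<omega>. y i \<omega> ^ k i)\<bar>)"
    using finite_I indep' integrable_power
    by (subst indep_vars_lebesgue_integral) (auto simp: abs_prod)
  also have "\<dots> \<le> (\<Prod>i\<in>I. if k i = 0 then 1 else if k i = 1 then 0 else q i)"
    using expectation_power_le by (intro prod_mono) auto
  also have "\<dots> \<le> (\<Prod>i\<in>{i\<in>I. 1 \<le> k i}. q i) * of_bool ({i\<in>I. k i = 1} = {})"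
  proof (cases "{i\<in>I. k i = 1} = {}")
    case True
    then have "(\<Prod>i\<in>I. if k i = 0 then 1 else if k i = 1 then 0 else q i)
        = (\<Prod>i\<in>I. if 1 \<le> k i then q i else 1)"
      by (intro prod.cong) auto
    then show ?thesis
      using True by (simp only: prod.inter_filter[OF finite_I]) simp
  next
    case False
    then have "(\<Prod>i\<in>I. if k i = 0 then 1 else if k i = 1 then 0 else q i) = 0"
      using finite_I by (auto intro!: prod_zero)
    moreover have "0 \<le> (\<Prod>i\<in>{i\<in>I. 1 \<le> k i}. q i) * of_bool ({i\<in>I. k i = 1} = {})"
      by (intro mult_nonneg_nonneg prod_nonneg) (auto simp: q_nonneg)
    ultimately show ?thesis by linarith
  qed
  finally show "\<bar>expectation (\<lambda>\<omega>. \<Prod>i\<in>I. y i \<omega> ^ k i)\<bar>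
    \<le> (\<Prod>i\<in>{i\<in>I. 1 \<le> k i}. q i) * of_bool ({i\<in>I. k i = 1} = {})" .
qed

section \<open>Walk expansion of the matrix powers\<close>

lemma monomial_step:
  assumes i: "i \<in> I"
  shows "(\<Prod>j\<in>I. y j \<omega> ^ (k(i := Suc (k i))) j) = y i \<omega> * (\<Prod>j\<in>I. y j \<omega> ^ k j)"
proof -
  have "(\<Prod>j\<in>I - {i}. y j \<omega> ^ (k(i := Suc (k i))) j) = (\<Prod>j\<in>I - {i}. y j \<omega> ^ k j)"
    by (intro prod.cong) auto
  then show ?thesis
    using prod.remove[OF finite_I i, of "\<lambda>j. y j \<omega> ^ (k(i := Suc (k i))) j"]
      prod.remove[OF finite_I i, of "\<lambda>j. y j \<omega> ^ k j"] by simp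
qed

text \<open>The last step of the walk from \<open>u\<close> to \<open>v\<close> is split off, and
  its random coefficient is absorbed into the monomial by raising one multiplicity. This keeps the
  expression in the same shape for an induction on \<open>m\<close>.\<close>

lemma monomial_pow_step:
  assumes "u < n" "v < n"
  shows "(\<Prod>j\<in>I. y j \<omega> ^ k j) * (S \<omega> ^\<^sub>m Suc m) $$ (u, v)
    = (\<Sum>i\<in>I. \<Sum>x<n. B i $$ (x, v)
        * ((\<Prod>j\<in>I. y j \<omega> ^ (k(i := Suc (k i))) j) * (S \<omega> ^\<^sub>m m) $$ (u, x)))"
proof -
  have dim: "dim_row (S \<omega>) = n" "dim_col (S \<omega>) = n"
    using S_carrier[of \<omega>] by blast+
  have "(S \<omega> ^\<^sub>m Suc m) $$ (u, v) = (\<Sum>x<n. (S \<omega> ^\<^sub>m m) $$ (u, x) * S \<omega> $$ (x, v))"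
    using assms dim by (auto simp: scalar_prod_def atLeast0LessThan)
  also have "\<dots> = (\<Sum>x<n. \<Sum>i\<in>I. (S \<omega> ^\<^sub>m m) $$ (u, x) * (y i \<omega> * B i $$ (x, v)))"
    using assms by (intro sum.cong) (auto simp: S_def sum_distrib_left)
  also have "\<dots> = (\<Sum>i\<in>I. \<Sum>x<n. (S \<omega> ^\<^sub>m m) $$ (u, x) * (y i \<omega> * B i $$ (x, v)))"
    by (rule sum.swap)
  finally show ?thesis
    by (simp add: sum_distrib_left monomial_step mult_ac del: fun_upd_apply cong: sum.cong)
qed

lemma monomial_pow_integrable:
  assumes "u < n" "v < n"
  shows "integrable M (\<lambda>\<omega>. (\<Prod>i\<in>I. y i \<omega> ^ k i) * (S \<omega> ^\<^sub>m m) $$ (u, v))"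
  using assms
proof (induction m arbitrary: k v)
  case 0
  moreover have "dim_row (S \<omega>) = n" for \<omega> using S_carrier[of \<omega>] by blast
  ultimately show ?case using monomial_integrable[of k] by (simp add: integrable_mult_left)
next
  case (Suc m)
  then show ?case
    by (subst monomial_pow_step) (auto simp del: fun_upd_apply intro!: Bochner_Integration.integrable_sum)
qed

text \<open>The letter read is new, seen once or seen at least twice; these cases produce the three
  summands in the recursion of \<open>collision_moment\<close>. Only a new letter brings in a factor
  \<open>q i\<close>.\<close>

lemma monomial_weight_step:
  assumes i: "i \<in> I" and v: "v < n"
  shows "(\<Prod>j\<in>{j\<in>I. 1 \<le> (k(i := Suc (k i))) j}. q j)
      * collision_moment R D m (card {j\<in>I. (k(i := Suc (k i))) j = 1})
          (card {j\<in>I. 2 \<le> (k(i := Suc (k i))) j})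
    = (\<Prod>j\<in>{j\<in>I. 1 \<le> k j}. q j) *
      (if k i = 0 then q i * collision_moment R D m (Suc (card {j\<in>I. k j = 1})) (card {j\<in>I. 2 \<le> k j})
       else if k i = 1 then
         collision_moment R D m (card {j\<in>I. k j = 1} - 1) (Suc (card {j\<in>I. 2 \<le> k j}))
       else collision_moment R D m (card {j\<in>I. k j = 1}) (card {j\<in>I. 2 \<le> k j}))"
proof -
  let ?k = "k(i := Suc (k i))"
  consider "k i = 0" | "k i = 1" | "2 \<le> k i" by linarith
  then show ?thesis
  proof cases
    case 1
    then have "{j\<in>I. 1 \<le> ?k j} = insert i {j\<in>I. 1 \<le> k j}"
      "{j\<in>I. ?k j = 1} = insert i {j\<in>I. k j = 1}" "{j\<in>I. 2 \<le> ?k j} = {j\<in>I. 2 \<le> k j}"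
      using i by auto
    then show ?thesis using 1 finite_I by (simp del: fun_upd_apply)
  next
    case 2
    then have "{j\<in>I. 1 \<le> ?k j} = {j\<in>I. 1 \<le> k j}"
      "{j\<in>I. ?k j = 1} = {j\<in>I. k j = 1} - {i}" "{j\<in>I. 2 \<le> ?k j} = insert i {j\<in>I. 2 \<le> k j}"
      using i by auto
    then show ?thesis using 2 i finite_I by (simp del: fun_upd_apply)
  next
    case 3
    then have "{j\<in>I. 1 \<le> ?k j} = {j\<in>I. 1 \<le> k j}"
      "{j\<in>I. ?k j = 1} = {j\<in>I. k j = 1}" "{j\<in>I. 2 \<le> ?k j} = {j\<in>I. 2 \<le> k j}"
      using i by auto
    then show ?thesis using 3 by (simp del: fun_upd_apply)
  qed
qed

text \<open>The powers of \<open>S\<close> are not independent of the letters already read, so the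
  induction carries an arbitrary word prefix \<open>k\<close>. Fixing the end \<open>v\<close> and
  summing over the start \<open>u\<close> lets each step be bounded by one column sum.\<close>

lemma monomial_pow_expectation_le:
  assumes "v < n"
  shows "(\<Sum>u<n. \<bar>expectation (\<lambda>\<omega>. (\<Prod>i\<in>I. y i \<omega> ^ k i) * (S \<omega> ^\<^sub>m m) $$ (u, v))\<bar>)
    \<le> (\<Prod>i\<in>{i\<in>I. 1 \<le> k i}. q i)
      * collision_moment R D m (card {i\<in>I. k i = 1}) (card {i\<in>I. 2 \<le> k i})"
  using assms
proof (induction m arbitrary: k v)
  case 0
  have "dim_row (S \<omega>) = n" for \<omega> using S_carrier[of \<omega>] by blast
  then have "(\<Sum>u<n. \<bar>expectation (\<lambda>\<omega>. (\<Prod>i\<in>I. y i \<omega> ^ k i) * (S \<omega> ^\<^sub>m 0) $$ (u, v))\<bar>)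
    = (\<Sum>u<n. if u = v then \<bar>expectation (\<lambda>\<omega>. \<Prod>i\<in>I. y i \<omega> ^ k i)\<bar> else 0)"
    using 0 by (intro sum.cong) auto
  also have "\<dots> = \<bar>expectation (\<lambda>\<omega>. \<Prod>i\<in>I. y i \<omega> ^ k i)\<bar>"
    using 0 by simp
  also have "\<dots> \<le> (\<Prod>i\<in>{i\<in>I. 1 \<le> k i}. q i) * of_bool ({i\<in>I. k i = 1} = {})"
    by (rule monomial_expectation_le)
  finally show ?case using finite_I by simp
next
  case (Suc m)
  note v = \<open>v < n\<close>
  let ?k = "\<lambda>i. k(i := Suc (k i))"
  let ?E = "\<lambda>k u v. expectation (\<lambda>\<omega>. (\<Prod>j\<in>I. y j \<omega> ^ k j) * (S \<omega> ^\<^sub>m m) $$ (u, v))"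
  let ?W = "\<lambda>k. (\<Prod>j\<in>{j\<in>I. 1 \<le> k j}. q j)
    * collision_moment R D m (card {j\<in>I. k j = 1}) (card {j\<in>I. 2 \<le> k j})"
  define b where "b i = (\<Sum>x<n. B i $$ (x, v))" for i
  define P where "P = (\<Prod>j\<in>{j\<in>I. 1 \<le> k j}. q j)"
  define s where "s = card {j\<in>I. k j = 1}"
  define f where "f = card {j\<in>I. 2 \<le> k j}"
  define c where "c = collision_moment R D m"
  have c_nonneg: "0 \<le> c s f" for s f
    using R_pos D_nonneg by (simp add: c_def collision_moment_nonneg)
  have P_nonneg: "0 \<le> P" unfolding P_def by (intro prod_nonneg) (auto simp: q_nonneg)
  have b_nonneg: "0 \<le> b i" if "i \<in> I" for i
    unfolding b_def using v that by (intro sum_nonneg) (auto intro: B_nonneg)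
  have "(\<Sum>u<n. \<bar>expectation (\<lambda>\<omega>. (\<Prod>i\<in>I. y i \<omega> ^ k i) * (S \<omega> ^\<^sub>m Suc m) $$ (u, v))\<bar>)
      = (\<Sum>u<n. \<bar>\<Sum>i\<in>I. \<Sum>x<n. B i $$ (x, v) * ?E (?k i) u x\<bar>)"
  proof (intro sum.cong refl arg_cong[where f = abs])
    fix u assume "u \<in> {..<n}"
    then have int: "integrable M (\<lambda>\<omega>. B i $$ (x, v)
        * ((\<Prod>j\<in>I. y j \<omega> ^ (?k i) j) * (S \<omega> ^\<^sub>m m) $$ (u, x)))" if "x < n" for i x
      using that by (intro integrable_mult_right monomial_pow_integrable) auto
    have "expectation (\<lambda>\<omega>. (\<Prod>i\<in>I. y i \<omega> ^ k i) * (S \<omega> ^\<^sub>m Suc m) $$ (u, v))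
      = expectation (\<lambda>\<omega>. \<Sum>i\<in>I. \<Sum>x<n. B i $$ (x, v)
        * ((\<Prod>j\<in>I. y j \<omega> ^ (?k i) j) * (S \<omega> ^\<^sub>m m) $$ (u, x)))"
      using v \<open>u \<in> {..<n}\<close> by (simp only: monomial_pow_step lessThan_iff)
    also have "\<dots> = (\<Sum>i\<in>I. expectation (\<lambda>\<omega>. \<Sum>x<n. B i $$ (x, v)
        * ((\<Prod>j\<in>I. y j \<omega> ^ (?k i) j) * (S \<omega> ^\<^sub>m m) $$ (u, x))))"
      using int by (intro Bochner_Integration.integral_sum Bochner_Integration.integrable_sum) auto
    also have "\<dots> = (\<Sum>i\<in>I. \<Sum>x<n. expectation (\<lambda>\<omega>. B i $$ (x, v)
        * ((\<Prod>j\<in>I. y j \<omega> ^ (?k i) j) * (S \<omega> ^\<^sub>m m) $$ (u, x))))"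
      using int by (intro sum.cong refl Bochner_Integration.integral_sum) auto
    finally show "expectation (\<lambda>\<omega>. (\<Prod>i\<in>I. y i \<omega> ^ k i) * (S \<omega> ^\<^sub>m Suc m) $$ (u, v))
      = (\<Sum>i\<in>I. \<Sum>x<n. B i $$ (x, v) * ?E (?k i) u x)"
      by (simp only: Bochner_Integration.integral_mult_right_zero)
  qed
  \<comment> \<open>Absolute values pass through the weights \<open>B i\<close> at no cost; this is
    where entrywise nonnegativity enters.\<close>
  also have "\<dots> \<le> (\<Sum>u<n. \<Sum>i\<in>I. \<Sum>x<n. B i $$ (x, v) * \<bar>?E (?k i) u x\<bar>)"
  proof (intro sum_mono)
    fix u
    have "\<bar>\<Sum>i\<in>I. \<Sum>x<n. B i $$ (x, v) * ?E (?k i) u x\<bar>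
      \<le> (\<Sum>i\<in>I. \<Sum>x<n. \<bar>B i $$ (x, v) * ?E (?k i) u x\<bar>)"
      by (rule order_trans[OF sum_abs sum_mono[OF sum_abs]])
    also have "\<dots> = (\<Sum>i\<in>I. \<Sum>x<n. B i $$ (x, v) * \<bar>?E (?k i) u x\<bar>)"
      using v by (intro sum.cong) (auto simp: abs_mult B_nonneg simp del: fun_upd_apply)
    finally show "\<bar>\<Sum>i\<in>I. \<Sum>x<n. B i $$ (x, v) * ?E (?k i) u x\<bar>
      \<le> (\<Sum>i\<in>I. \<Sum>x<n. B i $$ (x, v) * \<bar>?E (?k i) u x\<bar>)" .
  qed
  also have "\<dots> = (\<Sum>i\<in>I. \<Sum>x<n. B i $$ (x, v) * (\<Sum>u<n. \<bar>?E (?k i) u x\<bar>))"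
    by (subst sum.swap, rule sum.cong[OF refl], subst sum.swap) (simp add: sum_distrib_left del: fun_upd_apply)
  also have "\<dots> \<le> (\<Sum>i\<in>I. \<Sum>x<n. B i $$ (x, v) * ?W (?k i))"
    using v by (intro sum_mono mult_left_mono Suc.IH B_nonneg) auto
  also have "\<dots> = (\<Sum>i\<in>I. b i * ?W (?k i))"
    by (simp only: b_def sum_distrib_right)
  also have "\<dots> = (\<Sum>i\<in>I. b i * (P * (if k i = 0 then q i * c (Suc s) f
      else if k i = 1 then c (s - 1) (Suc f) else c s f)))"
    unfolding P_def s_def f_def c_def using v
    by (intro sum.cong refl) (simp only: monomial_weight_step)
  \<comment> \<open>The letters are split by multiplicity, so that each class is multiplied by a
    constant.\<close>
  also have "\<dots> = (\<Sum>i\<in>I. (if k i = 0 then q i * b i else 0) * (P * c (Suc s) f)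
      + (if k i = 1 then b i else 0) * (P * c (s - 1) (Suc f))
      + (if 2 \<le> k i then b i else 0) * (P * c s f))"
    by (intro sum.cong) auto
  also have "\<dots> = (\<Sum>i\<in>I. if k i = 0 then q i * b i else 0) * (P * c (Suc s) f)
      + (\<Sum>i\<in>I. if k i = 1 then b i else 0) * (P * c (s - 1) (Suc f))
      + (\<Sum>i\<in>I. if 2 \<le> k i then b i else 0) * (P * c s f)"
    by (simp only: sum.distrib sum_distrib_right)
  also have "\<dots> \<le> D * (P * c (Suc s) f) + (real s * R) * (P * c (s - 1) (Suc f))
      + (real f * R) * (P * c s f)"
  \<comment> \<open>For new letters the sum is enlarged to all of \<open>I\<close> and bounded by
    \<open>D\<close>. There are only \<open>s\<close> letters seen once and \<open>f\<close> seen
    more often, each with column sum at most \<open>R\<close>.\<close>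
  proof (intro add_mono mult_right_mono)
    have "(\<Sum>i\<in>I. if k i = 0 then q i * b i else 0) \<le> (\<Sum>i\<in>I. q i * b i)"
      using q_nonneg b_nonneg by (intro sum_mono) auto
    then show "(\<Sum>i\<in>I. if k i = 0 then q i * b i else 0) \<le> D"
      using mean_col_sum[OF v] by (simp add: b_def)
    have restrict: "(\<Sum>i\<in>I. if Q (k i) then b i else 0) \<le> real (card {i\<in>I. Q (k i)}) * R" for Q
    proof -
      have "(\<Sum>i\<in>I. if Q (k i) then b i else 0) = (\<Sum>i\<in>{i\<in>I. Q (k i)}. b i)"
        by (rule sum.inter_filter[OF finite_I, symmetric])
      also have "\<dots> \<le> real (card {i\<in>I. Q (k i)}) * R"
        unfolding b_def using v by (intro sum_bounded_above) (auto intro: B_col_sum)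
      finally show ?thesis .
    qed
    show "(\<Sum>i\<in>I. if k i = 1 then b i else 0) \<le> real s * R"
      unfolding s_def by (rule restrict)
    show "(\<Sum>i\<in>I. if 2 \<le> k i then b i else 0) \<le> real f * R"
      unfolding f_def by (rule restrict)
  qed (use P_nonneg c_nonneg in auto)
  also have "\<dots> = P * collision_moment R D (Suc m) s f"
    by (simp add: c_def algebra_simps)
  finally show ?case by (simp only: P_def s_def f_def)
qed

section \<open>Trace moments and the tail bound\<close>

definition trace_pow :: "nat \<Rightarrow> 'a \<Rightarrow> real" where
  "trace_pow m \<omega> = (\<Sum>u<n. (S \<omega> ^\<^sub>m m) $$ (u, u))"

lemma trace_pow_integrable: "integrable M (trace_pow m)"
  unfolding trace_pow_def
  using monomial_pow_integrable[of _ _ "\<lambda>_. 0" m]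
  by (intro Bochner_Integration.integrable_sum) simp

lemma expectation_trace_pow_le: "expectation (trace_pow m) \<le> real n * collision_moment R D m 0 0"
proof -
  have int: "integrable M (\<lambda>\<omega>. (S \<omega> ^\<^sub>m m) $$ (u, v))" if "u < n" "v < n" for u v
    using monomial_pow_integrable[OF that, of "\<lambda>_. 0" m] by simp
  have "expectation (trace_pow m) = (\<Sum>v<n. expectation (\<lambda>\<omega>. (S \<omega> ^\<^sub>m m) $$ (v, v)))"
    unfolding trace_pow_def using int by (intro Bochner_Integration.integral_sum) auto
  \<comment> \<open>Each diagonal entry is replaced by its whole column, to which the walk bound
    with empty prefix applies. The \<open>n\<close> columns give the dimension factor.\<close>
  also have "\<dots> \<le> (\<Sum>v<n. \<Sum>u<n. \<bar>expectation (\<lambda>\<omega>. (S \<omega> ^\<^sub>m m) $$ (u, v))\<bar>)"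
  proof (intro sum_mono)
    fix v assume v: "v \<in> {..<n}"
    have "expectation (\<lambda>\<omega>. (S \<omega> ^\<^sub>m m) $$ (v, v)) \<le> \<bar>expectation (\<lambda>\<omega>. (S \<omega> ^\<^sub>m m) $$ (v, v))\<bar>"
      by simp
    also have "\<dots> \<le> (\<Sum>u<n. \<bar>expectation (\<lambda>\<omega>. (S \<omega> ^\<^sub>m m) $$ (u, v))\<bar>)"
      using v by (intro member_le_sum) auto
    finally show "expectation (\<lambda>\<omega>. (S \<omega> ^\<^sub>m m) $$ (v, v))
      \<le> (\<Sum>u<n. \<bar>expectation (\<lambda>\<omega>. (S \<omega> ^\<^sub>m m) $$ (u, v))\<bar>)" .
  qed
  also have "\<dots> \<le> (\<Sum>v<n. collision_moment R D m 0 0)"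
  proof (intro sum_mono)
    fix v assume v: "v \<in> {..<n}"
    show "(\<Sum>u<n. \<bar>expectation (\<lambda>\<omega>. (S \<omega> ^\<^sub>m m) $$ (u, v))\<bar>) \<le> collision_moment R D m 0 0"
      using monomial_pow_expectation_le[of v "\<lambda>_. 0" m] v by simp
  qed
  finally show ?thesis by simp
qed

lemma even_trace_pow_nonneg: "even m \<Longrightarrow> 0 \<le> trace_pow m \<omega>"
  unfolding trace_pow_def
  by (auto elim!: evenE simp: diag_pow_mat_symmetric[OF S_carrier S_transpose] intro!: sum_nonneg)

text \<open>Markov's inequality for truncations of the trace of cosh. Only even powers are used,
  since their traces are nonnegative and dominate powers of the norm. Truncating keeps every
  expectation a finite sum.\<close>

lemma norm_tail_bound:
  assumes A: "A \<in> events"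
    and large: "\<And>\<omega>. \<omega> \<in> A \<Longrightarrow> \<exists>v\<in>carrier_vec n. vec_norm2 v = 1 \<and> t \<le> vec_norm2 (S \<omega> *\<^sub>v v)"
    and "0 \<le> t" and "0 \<le> \<theta>"
  shows "prob A \<le> 2 * real n * exp (D / R * (exp (R * \<theta>) - 1 - R * \<theta>) - \<theta> * t)"
proof -
  define G where "G = exp (D / R * (exp (R * \<theta>) - 1 - R * \<theta>))"
  define C where "C K = (\<Sum>m<K. if even m then (\<theta> * t) ^ m /\<^sub>R fact m else 0)" for K :: nat
  define Z where "Z K \<omega> = (\<Sum>m<K. if even m then \<theta> ^ m / fact m * trace_pow m \<omega> else 0)" for K :: nat and \<omega>
  have term_int: "integrable M (\<lambda>\<omega>. if even m then \<theta> ^ m / fact m * trace_pow m \<omega> else 0)" for m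
    using trace_pow_integrable[of m] by (cases "even m") simp_all
  have markov: "C K * prob A \<le> real n * G" for K
  proof -
    have int: "integrable M (Z K)"
      unfolding Z_def using term_int by (intro Bochner_Integration.integrable_sum)
    have "C K * prob A = expectation (\<lambda>\<omega>. C K * indicator A \<omega>)"
      using A by simp
    also have "\<dots> \<le> expectation (Z K)"
    proof (rule integral_mono)
      show "integrable M (\<lambda>\<omega>. C K * indicator A \<omega>)"
        using A by (intro integrable_mult_right) (auto simp: less_top[symmetric])
      show "integrable M (Z K)" by (rule int)
      fix \<omega> assume "\<omega> \<in> space M"
      have nonneg: "0 \<le> Z K \<omega>"
        unfolding Z_def using \<open>0 \<le> \<theta>\<close> even_trace_pow_nonneg by (intro sum_nonneg) auto
      show "C K * indicator A \<omega> \<le> Z K \<omega>"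
      proof (cases "\<omega> \<in> A")
        case True
        from large[OF True] obtain v
          where v: "v \<in> carrier_vec n" "vec_norm2 v = 1" "t \<le> vec_norm2 (S \<omega> *\<^sub>v v)" by auto
        have "t ^ m \<le> trace_pow m \<omega>" if "even m" for m
        proof -
          from that obtain k where m: "m = 2 * k" by (elim evenE)
          have "t ^ m \<le> vec_norm2 (S \<omega> *\<^sub>v v) ^ m"
            using v(3) \<open>0 \<le> t\<close> by (rule power_mono)
          also have "\<dots> \<le> trace_pow m \<omega>"
            unfolding m trace_pow_def by (rule norm_power_le_trace[OF S_carrier S_transpose v(1,2)])
          finally show ?thesis .
        qed
        then have "C K \<le> Z K \<omega>"
          unfolding C_def Z_def using \<open>0 \<le> \<theta>\<close>
          by (intro sum_mono) (auto simp: power_mult_distrib divide_simps intro!: mult_left_mono)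
        then show ?thesis using True by simp
      qed (use nonneg in simp)
    qed
    also have "\<dots> = (\<Sum>m<K. if even m then \<theta> ^ m / fact m * expectation (trace_pow m) else 0)"
      unfolding Z_def using term_int
      by (subst Bochner_Integration.integral_sum) (auto intro!: sum.cong)
    \<comment> \<open>The odd terms may be added because collision moments are nonnegative; this
      completes the partial sum of the full exponential generating function.\<close>
    also have "\<dots> \<le> (\<Sum>m<K. \<theta> ^ m / fact m * (real n * collision_moment R D m 0 0))"
    proof (intro sum_mono)
      fix m
      have "0 \<le> \<theta> ^ m / fact m" using \<open>0 \<le> \<theta>\<close> by simp
      then show "(if even m then \<theta> ^ m / fact m * expectation (trace_pow m) else 0)
          \<le> \<theta> ^ m / fact m * (real n * collision_moment R D m 0 0)"
        using expectation_trace_pow_le[of m] collision_moment_nonneg[of R D m 0 0] R_pos D_nonneg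
        by (simp add: mult_left_mono del: times_divide_eq_left)
    qed
    also have "\<dots> = real n * (\<Sum>m<K. \<theta> ^ m / fact m * collision_moment R D m 0 0)"
      by (simp add: sum_distrib_left mult_ac)
    also have "\<dots> \<le> real n * G"
      using collision_moment_egf_le[OF R_pos D_nonneg \<open>0 \<le> \<theta>\<close>, where K = K and s = 0 and f = 0]
      by (intro mult_left_mono) (auto simp: G_def)
    finally show ?thesis .
  qed
  \<comment> \<open>The limit is taken only after Markov's inequality. The bound of cosh by half an
    exponential is the source of the factor 2.\<close>
  have "C \<longlonglongrightarrow> cosh (\<theta> * t)"
    using cosh_converges[of "\<theta> * t"] unfolding C_def sums_def .
  then have "(\<lambda>K. C K * prob A) \<longlonglongrightarrow> cosh (\<theta> * t) * prob A"
    by (intro tendsto_intros)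
  then have "cosh (\<theta> * t) * prob A \<le> real n * G"
    using markov by (intro LIMSEQ_le_const2) auto
  moreover have "exp (\<theta> * t) / 2 \<le> cosh (\<theta> * t)"
    by (simp add: cosh_field_def)
  then have "exp (\<theta> * t) / 2 * prob A \<le> cosh (\<theta> * t) * prob A"
    by (intro mult_right_mono) auto
  ultimately have "exp (\<theta> * t) / 2 * prob A \<le> real n * G" by linarith
  then show ?thesis by (simp add: G_def exp_diff field_simps)
qed

end

text \<open>An event determined by finitely many Boolean variables is a finite union of cells on
  which all of them are constant. Norm events thus become measurable without any regularity of the
  norm itself.\<close>

lemma (in prob_space) finite_bool_family_event:
  fixes X :: "'i \<Rightarrow> 'a \<Rightarrow> bool"
  assumes "finite I" and X: "\<And>i. i \<in> I \<Longrightarrow> X i \<in> M \<rightarrow>\<^sub>M count_space UNIV"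
    and Q: "\<And>\<omega> \<omega>'. (\<And>i. i \<in> I \<Longrightarrow> X i \<omega> = X i \<omega>') \<Longrightarrow> Q \<omega> \<longleftrightarrow> Q \<omega>'"
  shows "{\<omega> \<in> space M. Q \<omega>} \<in> events"
proof -
  define pattern where "pattern \<omega> = {i \<in> I. X i \<omega>}" for \<omega>
  have decompose: "{\<omega> \<in> space M. Q \<omega>}
      = (\<Union>J \<in> pattern ` {\<omega> \<in> space M. Q \<omega>}. {\<omega> \<in> space M. \<forall>i\<in>I. X i \<omega> = (i \<in> J)})"
    (is "_ = ?U")
  proof (intro equalityI subsetI)
    fix \<omega> assume "\<omega> \<in> ?U"
    then obtain \<omega>' where "Q \<omega>'" "\<omega> \<in> space M" "\<forall>i\<in>I. X i \<omega> = X i \<omega>'"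
      by (auto simp: pattern_def)
    then show "\<omega> \<in> {\<omega> \<in> space M. Q \<omega>}" using Q[of \<omega> \<omega>'] by simp
  qed (auto simp: pattern_def)
  have "finite (pattern ` {\<omega> \<in> space M. Q \<omega>})"
    using \<open>finite I\<close> by (rule finite_subset[rotated, OF finite_Pow_iff[THEN iffD2]]) (auto simp: pattern_def)
  moreover have "{\<omega> \<in> space M. \<forall>i\<in>I. X i \<omega> = (i \<in> J)} \<in> events" for J
    using \<open>finite I\<close>
  proof (rule sets.sets_Collect_finite_All[rotated])
    fix i assume "i \<in> I"
    then have "X i -` {i \<in> J} \<inter> space M \<in> events"
      using X by (intro measurable_sets[of _ _ "count_space UNIV"]) auto
    moreover have "X i -` {i \<in> J} \<inter> space M = {\<omega> \<in> space M. X i \<omega> = (i \<in> J)}" by auto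
    ultimately show "{\<omega> \<in> space M. X i \<omega> = (i \<in> J)} \<in> events" by simp
  qed
  ultimately show ?thesis by (subst decompose) (intro sets.finite_UN)
qed

section \<open>The weighted subgraph generated model\<close>

lemma spectral_norm_le:
  assumes A: "A \<in> carrier_mat n n" and "0 < n"
    and le: "\<And>v. v \<in> carrier_vec n \<Longrightarrow> vec_norm2 v = 1 \<Longrightarrow> vec_norm2 (A *\<^sub>v v) \<le> t"
  shows "spectral_norm A \<le> t"
proof -
  \<comment> \<open>A unit vector must exist for the supremum to range over a nonempty set; this
    uses \<open>0 < n\<close>.\<close>
  have "vec_norm2 (unit_vec n 0) = 1"
    using \<open>0 < n\<close> by (simp add: vec_norm2_def)
  then have "unit_vec n 0 \<in> {v \<in> carrier_vec (dim_col A). vec_norm2 v = 1}"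
    using A by simp
  then show ?thesis
    unfolding spectral_norm_def using A le by (intro cSUP_least) blast+
qed

lemma row_sum_le_mat_norm_inf:
  assumes "i < dim_row A"
  shows "(\<Sum>j<dim_col A. \<bar>A $$ (i, j)\<bar>) \<le> mat_norm_inf A"
  unfolding mat_norm_inf_def using assms by (intro Max_ge) auto

lemma finite_placements: "finite (placements n m)"
  by (rule finite_subset[OF _ finite_lists_length_eq[of "{0..<n}" m]]) (auto simp: placements_def)

text \<open>An edge has two distinct ends. The bound 2 later absorbs the constant of the quadratic
  estimate for the exponential.\<close>

lemma subgraph_type_size_ge_2:
  assumes "subgraph_type t"
  shows "2 \<le> type_size t"
proof -
  interpret pair_graph t using assms by (simp add: subgraph_type_def)
  obtain a b where ab: "(a, b) \<in> parcs t" using assms by (auto simp: subgraph_type_def)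
  then have "{a, b} \<subseteq> pverts t" "a \<noteq> b"
    using in_arcsD1 in_arcsD2 no_loops'[of a] by blast+
  then have "card {a, b} \<le> type_size t"
    unfolding type_size_def by (intro card_mono) auto
  then show ?thesis using \<open>a \<noteq> b\<close> by simp
qed

lemma copy_adj_nonneg: "u < n \<Longrightarrow> v < n \<Longrightarrow> 0 \<le> copy_adj n t L $$ (u, v)"
  by (simp add: copy_adj_def)

lemma copy_adj_sym:
  assumes "subgraph_type t" and "u < n" and "v < n"
  shows "copy_adj n t L $$ (u, v) = copy_adj n t L $$ (v, u)"
proof -
  interpret pair_graph t using assms by (simp add: subgraph_type_def)
  have "(v, u) \<in> parcs (subgraph_copy t L)" if "(u, v) \<in> parcs (subgraph_copy t L)" for u v
    using that arcs_symmetric by (force simp: subgraph_copy_def)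
  then show ?thesis using assms by (auto simp: copy_adj_def)
qed

text \<open>The neighbours of \<open>v\<close> in the copy all lie among the
  \<open>type_size t\<close> distinct nodes of \<open>L\<close>.\<close>

lemma copy_adj_col_sum_le:
  assumes t: "subgraph_type t" and L: "L \<in> placements n (type_size t)" and "v < n"
  shows "(\<Sum>u<n. copy_adj n t L $$ (u, v)) \<le> real (type_size t)"
proof -
  interpret pair_graph t using t by (simp add: subgraph_type_def)
  have "(\<Sum>u<n. copy_adj n t L $$ (u, v)) = real (card {u. u < n \<and> (u, v) \<in> parcs (subgraph_copy t L)})"
    using \<open>v < n\<close> by (simp add: copy_adj_def Int_def)
  also have "card {u. u < n \<and> (u, v) \<in> parcs (subgraph_copy t L)} \<le> card (set L)"
  proof (intro card_mono subsetI)
    fix u assume "u \<in> {u. u < n \<and> (u, v) \<in> parcs (subgraph_copy t L)}"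
    then obtain a b where ab: "(a, b) \<in> parcs t" "u = L ! a" by (auto simp: subgraph_copy_def)
    then have "a \<in> pverts t" using in_arcsD1 by blast
    then have "a < length L" using t L by (auto simp: subgraph_type_def placements_def)
    then show "u \<in> set L" using ab by simp
  qed simp
  also have "card (set L) = type_size t" using L by (auto simp: placements_def distinct_card)
  finally show ?thesis by simp
qed

section \<open>The centred model as a random matrix series\<close>

context wSUGM
begin

definition copies :: "(nat pair_pre_digraph \<times> nat list) set" where
  "copies = (SIGMA t:T. placements n (type_size t))"

lemma formed_measurable: "(t, L) \<in> copies \<Longrightarrow> X t L \<in> M \<rightarrow>\<^sub>M count_space UNIV"
  using indep by (auto simp: copies_def indep_vars_def)

lemma expectation_formed:
  fixes f :: "bool \<Rightarrow> real"
  assumes "(t, L) \<in> copies"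
  shows "expectation (\<lambda>\<omega>. f (X t L \<omega>)) = f True * p t L + f False * (1 - p t L)"
proof -
  have "expectation (\<lambda>\<omega>. f (X t L \<omega>)) = (\<integral>b. f b \<partial>distr M (count_space UNIV) (X t L))"
    using formed_measurable[OF assms] by (subst integral_distr) auto
  then show ?thesis
    using bernoulli[of t L] prob_range[of t L] assms by (simp add: copies_def)
qed

lemma formed_integrable:
  fixes f :: "bool \<Rightarrow> real"
  assumes "(t, L) \<in> copies"
  shows "integrable M (\<lambda>\<omega>. f (X t L \<omega>))"
proof (rule integrable_const_bound[of _ "max \<bar>f True\<bar> \<bar>f False\<bar>"])
  show "AE \<omega> in M. norm (f (X t L \<omega>)) \<le> max \<bar>f True\<bar> \<bar>f False\<bar>"
  proof (rule AE_I2)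
    fix \<omega> show "norm (f (X t L \<omega>)) \<le> max \<bar>f True\<bar> \<bar>f False\<bar>" by (cases "X t L \<omega>") auto
  qed
  show "(\<lambda>\<omega>. f (X t L \<omega>)) \<in> borel_measurable M"
    using formed_measurable[OF assms] by (rule measurable_compose) simp
qed

lemma finite_copies: "finite T \<Longrightarrow> finite copies"
  unfolding copies_def by (auto simp: finite_placements)

lemma wSUGM_adj_entry:
  assumes "finite T" "u < n" "v < n"
  shows "wSUGM_adj n T X \<omega> $$ (u, v)
    = (\<Sum>(t, L)\<in>copies. of_bool (X t L \<omega>) * copy_adj n t L $$ (u, v))"
proof -
  have "wSUGM_adj n T X \<omega> $$ (u, v) = (\<Sum>t\<in>T. \<Sum>L\<in>placements n (type_size t).
      of_bool (X t L \<omega>) * copy_adj n t L $$ (u, v))"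
    using assms by (simp add: wSUGM_adj_def)
  also have "\<dots> = (\<Sum>(t, L)\<in>copies. of_bool (X t L \<omega>) * copy_adj n t L $$ (u, v))"
    unfolding copies_def using assms by (intro sum.Sigma) (auto simp: finite_placements)
  finally show ?thesis .
qed

lemma expected_mat_entry:
  assumes "finite T" "u < n" "v < n"
  shows "expected_mat M n (wSUGM_adj n T X) $$ (u, v)
    = (\<Sum>(t, L)\<in>copies. p t L * copy_adj n t L $$ (u, v))"
proof -
  have "expected_mat M n (wSUGM_adj n T X) $$ (u, v)
      = expectation (\<lambda>\<omega>. \<Sum>(t, L)\<in>copies. of_bool (X t L \<omega>) * copy_adj n t L $$ (u, v))"
    using assms by (simp add: expected_mat_def wSUGM_adj_entry)
  also have "\<dots> = (\<Sum>(t, L)\<in>copies. expectation (\<lambda>\<omega>. of_bool (X t L \<omega>) * copy_adj n t L $$ (u, v)))"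
    unfolding case_prod_beta using formed_integrable[of _ _ of_bool]
    by (intro Bochner_Integration.integral_sum integrable_mult_left) auto
  also have "\<dots> = (\<Sum>(t, L)\<in>copies. p t L * copy_adj n t L $$ (u, v))"
    using expectation_formed[of _ _ of_bool] by (intro sum.cong) auto
  finally show ?thesis .
qed

text \<open>The variance \<open>p t L * (1 - p t L)\<close> is relaxed to \<open>p t L\<close>. With
  these weights the mean column sums are those of the expected adjacency matrix, so that
  \<open>D\<close> can be the maximum expected degree.\<close>

lemma centered_copies_series:
  assumes T: "finite T" "T \<noteq> {}" and types: "\<And>t. t \<in> T \<Longrightarrow> subgraph_type t"
    and "0 < n"
  shows "random_matrix_series M n copies (\<lambda>(t, L) \<omega>. of_bool (X t L \<omega>) - p t L)
    (\<lambda>(t, L). p t L) (\<lambda>(t, L). copy_adj n t L)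
    (real (Max (type_size ` T))) (mat_norm_inf (expected_mat M n (wSUGM_adj n T X)))"
proof
  show "finite copies" by (rule finite_copies[OF T(1)])
  show "indep_vars (\<lambda>_. borel) (\<lambda>(t, L) \<omega>. of_bool (X t L \<omega>) - p t L) copies"
    using indep_vars_compose2[OF indep, of "\<lambda>(t, L) b. of_bool b - p t L" "\<lambda>_. borel"]
    by (simp add: case_prod_beta' copies_def)
next
  fix i assume i: "i \<in> copies"
  obtain t L where tL: "i = (t, L)" by (cases i)
  have t: "subgraph_type t" and L: "L \<in> placements n (type_size t)" and "t \<in> T"
    using i types by (auto simp: tL copies_def)
  have p: "0 \<le> p t L" "p t L \<le> 1" using prob_range[OF \<open>t \<in> T\<close> L] by auto
  show "\<bar>(case i of (t, L) \<Rightarrow> \<lambda>\<omega>. of_bool (X t L \<omega>) - p t L) \<omega>\<bar> \<le> 1" for \<omega>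
    using p by (simp add: tL)
  show "expectation (case i of (t, L) \<Rightarrow> \<lambda>\<omega>. of_bool (X t L \<omega>) - p t L) = 0"
    using expectation_formed[OF i[unfolded tL], of "\<lambda>b. of_bool b - p t L"]
    by (simp add: tL algebra_simps)
  have "expectation (\<lambda>\<omega>. (of_bool (X t L \<omega>) - p t L)\<^sup>2) = p t L * (1 - p t L)"
    unfolding expectation_formed[OF i[unfolded tL], of "\<lambda>b. (of_bool b - p t L)\<^sup>2"]
    by (simp add: power2_eq_square algebra_simps)
  also have "\<dots> \<le> p t L" using p by (simp add: mult_left_le)
  finally show "expectation (\<lambda>\<omega>. ((case i of (t, L) \<Rightarrow> \<lambda>\<omega>. of_bool (X t L \<omega>) - p t L) \<omega>)\<^sup>2)
      \<le> (case i of (t, L) \<Rightarrow> p t L)"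
    by (simp add: tL)
  fix u v assume "u < n" "v < n"
  show "0 \<le> (case i of (t, L) \<Rightarrow> copy_adj n t L) $$ (u, v)"
    using \<open>u < n\<close> \<open>v < n\<close> by (simp add: tL copy_adj_nonneg)
  show "(case i of (t, L) \<Rightarrow> copy_adj n t L) $$ (u, v) = (case i of (t, L) \<Rightarrow> copy_adj n t L) $$ (v, u)"
    using \<open>u < n\<close> \<open>v < n\<close> t by (simp add: tL copy_adj_sym)
next
  fix i v assume i: "i \<in> copies" and "v < n"
  obtain t L where tL: "i = (t, L)" by (cases i)
  have t: "subgraph_type t" and L: "L \<in> placements n (type_size t)" and "t \<in> T"
    using i types by (auto simp: tL copies_def)
  have "(\<Sum>u<n. copy_adj n t L $$ (u, v)) \<le> real (type_size t)"
    by (rule copy_adj_col_sum_le[OF t L \<open>v < n\<close>])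
  also have "\<dots> \<le> real (Max (type_size ` T))" using T \<open>t \<in> T\<close> by simp
  finally show "(\<Sum>u<n. (case i of (t, L) \<Rightarrow> copy_adj n t L) $$ (u, v)) \<le> real (Max (type_size ` T))"
    by (simp add: tL)
next
  obtain t where "t \<in> T" using T by auto
  then have "type_size t \<le> Max (type_size ` T)" using T by simp
  then show "0 < real (Max (type_size ` T))"
    using subgraph_type_size_ge_2[OF types[OF \<open>t \<in> T\<close>]] by simp
next
  let ?E = "expected_mat M n (wSUGM_adj n T X)"
  have dim: "dim_row ?E = n" "dim_col ?E = n" by (simp_all add: expected_mat_def)
  \<comment> \<open>Row 0 exists since \<open>0 < n\<close>, so the maximum is over a nonempty
    set.\<close>
  have "0 \<le> (\<Sum>j<n. \<bar>?E $$ (0, j)\<bar>)" by (intro sum_nonneg) simp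
  also have "\<dots> \<le> mat_norm_inf ?E" using row_sum_le_mat_norm_inf[of 0 ?E] dim \<open>0 < n\<close> by simp
  finally show "0 \<le> mat_norm_inf ?E" .
  fix v assume v: "v < n"
  have "(\<Sum>i\<in>copies. (case i of (t, L) \<Rightarrow> p t L) * (\<Sum>u<n. (case i of (t, L) \<Rightarrow> copy_adj n t L) $$ (u, v)))
      = (\<Sum>u<n. \<Sum>(t, L)\<in>copies. p t L * copy_adj n t L $$ (u, v))"
    by (subst sum.swap) (simp add: sum_distrib_left case_prod_beta)
  \<comment> \<open>Symmetry turns the column sum into a row sum, as in
    \<open>mat_norm_inf\<close>.\<close>
  also have "\<dots> = (\<Sum>u<n. \<Sum>(t, L)\<in>copies. p t L * copy_adj n t L $$ (v, u))"
  proof (intro sum.cong refl)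
    fix u i assume "u \<in> {..<n}" "i \<in> copies"
    then show "(case i of (t, L) \<Rightarrow> p t L * copy_adj n t L $$ (u, v))
        = (case i of (t, L) \<Rightarrow> p t L * copy_adj n t L $$ (v, u))"
      using v types copy_adj_sym[of "fst i" u n v "snd i"] by (auto simp: copies_def)
  qed
  also have "\<dots> = (\<Sum>u<n. ?E $$ (v, u))"
    using v T by (simp add: expected_mat_entry)
  also have "\<dots> \<le> (\<Sum>u<n. \<bar>?E $$ (v, u)\<bar>)" by (intro sum_mono) simp
  also have "\<dots> \<le> mat_norm_inf ?E" using row_sum_le_mat_norm_inf[of v ?E] dim v by simp
  finally show "(\<Sum>i\<in>copies. (case i of (t, L) \<Rightarrow> p t L)
    * (\<Sum>u<n. (case i of (t, L) \<Rightarrow> copy_adj n t L) $$ (u, v))) \<le> mat_norm_inf ?E" .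
qed

lemma spectral_norm_deviation_tail:
  assumes T: "finite T" "T \<noteq> {}" and types: "\<And>t. t \<in> T \<Longrightarrow> subgraph_type t"
    and "0 < n" and "0 \<le> t" and "0 \<le> \<theta>"
  defines "R \<equiv> real (Max (type_size ` T))"
    and "E \<equiv> expected_mat M n (wSUGM_adj n T X)"
  shows "prob {\<omega> \<in> space M. spectral_norm (wSUGM_adj n T X \<omega> - E) \<le> t}
    \<ge> 1 - 2 * real n * exp (mat_norm_inf E / R * (exp (R * \<theta>) - 1 - R * \<theta>) - \<theta> * t)"
proof -
  interpret series: random_matrix_series M n copies "\<lambda>(t, L) \<omega>. of_bool (X t L \<omega>) - p t L"
    "\<lambda>(t, L). p t L" "\<lambda>(t, L). copy_adj n t L" R "mat_norm_inf E"
    unfolding R_def E_def using assms by (intro centered_copies_series) auto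
  have S: "wSUGM_adj n T X \<omega> - E = series.S \<omega>" for \<omega>
  proof (rule eq_matI)
    fix u v assume "u < dim_row (series.S \<omega>)" "v < dim_col (series.S \<omega>)"
    then have uv: "u < n" "v < n" by (simp_all add: series.S_def)
    then have "(wSUGM_adj n T X \<omega> - E) $$ (u, v) = wSUGM_adj n T X \<omega> $$ (u, v) - E $$ (u, v)"
      by (simp add: E_def expected_mat_def)
    then show "(wSUGM_adj n T X \<omega> - E) $$ (u, v) = series.S \<omega> $$ (u, v)"
      using uv T unfolding E_def
      by (simp add: wSUGM_adj_entry expected_mat_entry series.S_def sum_subtractf[symmetric]
        case_prod_beta left_diff_distrib)
  qed (simp_all add: E_def expected_mat_def series.S_def)
  let ?good = "{\<omega> \<in> space M. spectral_norm (wSUGM_adj n T X \<omega> - E) \<le> t}"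
  have good: "?good \<in> events"
  \<comment> \<open>The deviation depends on the outcome only through which of the finitely many
    copies are formed.\<close>
  proof (rule finite_bool_family_event[of copies "\<lambda>(t, L). X t L"])
    fix \<omega> \<omega>' assume "\<And>i. i \<in> copies \<Longrightarrow> (case i of (t, L) \<Rightarrow> X t L) \<omega> = (case i of (t, L) \<Rightarrow> X t L) \<omega>'"
    then have "series.S \<omega> = series.S \<omega>'"
      unfolding series.S_def by (intro cong_mat) (auto intro!: sum.cong)
    then show "spectral_norm (wSUGM_adj n T X \<omega> - E) \<le> t \<longleftrightarrow> spectral_norm (wSUGM_adj n T X \<omega>' - E) \<le> t"
      by (simp add: S)
  qed (use finite_copies T formed_measurable in auto)
  have "prob (space M - ?good)
      \<le> 2 * real n * exp (mat_norm_inf E / R * (exp (R * \<theta>) - 1 - R * \<theta>) - \<theta> * t)"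
  proof (rule series.norm_tail_bound)
    fix \<omega> assume "\<omega> \<in> space M - ?good"
    then have "\<not> spectral_norm (series.S \<omega>) \<le> t" by (simp add: S)
    \<comment> \<open>If every unit vector had image of norm below \<open>t\<close>, the supremum
      would be at most \<open>t\<close>; hence a witness exists whether or not the supremum is
      attained.\<close>
    then show "\<exists>v\<in>carrier_vec n. vec_norm2 v = 1 \<and> t \<le> vec_norm2 (series.S \<omega> *\<^sub>v v)"
      using spectral_norm_le[OF series.S_carrier \<open>0 < n\<close>] by (meson linear)
  qed (use good assms in auto)
  then show ?thesis using prob_compl[OF good] by simp
qed

end

section \<open>Choice of the exponent in the Bennett bound\<close>

lemma exp_le_quadratic:
  fixes r :: real
  assumes "0 \<le> r" "r \<le> 3 / 2"
  shows "exp r - 1 - r \<le> 2 * r\<^sup>2"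
proof -
  define h where "h = r / 2"
  \<comment> \<open>The estimate \<open>exp_bound\<close> holds on the unit interval only; halving
    \<open>r\<close> brings it down to at most 3/4.\<close>
  have h: "0 \<le> h" "h \<le> 3 / 4" and r: "r = h + h" using assms by (auto simp: h_def)
  have "exp r = (exp h)\<^sup>2"
    unfolding r exp_add power2_eq_square ..
  also have "\<dots> \<le> (1 + h + h\<^sup>2)\<^sup>2"
    using h by (intro power_mono exp_bound) auto
  also have "\<dots> = 1 + r + h\<^sup>2 * (3 + 2 * h + h * h)"
    unfolding r by (simp add: power2_eq_square algebra_simps)
  also have "\<dots> \<le> 1 + r + h\<^sup>2 * 8"
  proof -
    have "h * h \<le> 3 / 4 * (3 / 4)" using h by (intro mult_mono) auto
    then show ?thesis using h by (intro add_left_mono mult_left_mono) auto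
  qed
  also have "h\<^sup>2 * 8 = 2 * r\<^sup>2" unfolding r by (simp add: power2_eq_square)
  finally show ?thesis by simp
qed

text \<open>With \<open>r = R * \<theta>\<close> the choice of \<open>\<theta>\<close> gives
  \<open>D * r\<^sup>2 = l\<close>: the linear term is exactly \<open>2 * l\<close>, and the
  exponential term costs at most \<open>l\<close>. The hypothesis with 4/9 says that
  \<open>r\<close> stays below 3/2.\<close>

lemma bennett_exponent_le:
  fixes R D l :: real
  assumes "2 \<le> R" and "0 < l" and "4 / 9 * l < D"
  defines "\<theta> \<equiv> sqrt (l / D) / R"
  shows "D / R * (exp (R * \<theta>) - 1 - R * \<theta>) - \<theta> * sqrt (4 * R\<^sup>2 * D * l) \<le> - l"
proof -
  define r where "r = sqrt (l / D)"
  have D: "0 < D" using assms by linarith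
  have "l / D \<le> (3 / 2)\<^sup>2"
    using assms D by (simp add: pos_divide_le_eq power2_eq_square)
  then have "r \<le> 3 / 2" unfolding r_def by (intro real_le_lsqrt) auto
  moreover have "0 \<le> r" using assms D by (simp add: r_def)
  ultimately have r: "0 \<le> r" "r \<le> 3 / 2" by auto
  have rD: "D * r\<^sup>2 = l" using assms D by (simp add: r_def)
  have R\<theta>: "R * \<theta> = r" using \<open>2 \<le> R\<close> by (simp add: \<theta>_def r_def)
  \<comment> \<open>The factor 2 of the quadratic bound is cancelled by
    \<open>R \<ge> 2\<close>.\<close>
  have "D / R * (exp r - 1 - r) \<le> D / 2 * (2 * r\<^sup>2)"
  proof (intro mult_mono)
    show "D / R \<le> D / 2" using \<open>2 \<le> R\<close> D by (intro divide_left_mono) auto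
    show "0 \<le> exp r - 1 - r" using exp_ge_add_one_self[of r] by linarith
  qed (use exp_le_quadratic[OF r] D in auto)
  also have "\<dots> = l" using rD by simp
  finally have first: "D / R * (exp (R * \<theta>) - 1 - R * \<theta>) \<le> l" unfolding R\<theta> .
  have "4 * R\<^sup>2 * D * l = (2 * R * (D * r))\<^sup>2"
    unfolding rD[symmetric] by (simp add: power2_eq_square)
  then have "sqrt (4 * R\<^sup>2 * D * l) = 2 * R * (D * r)"
    using \<open>2 \<le> R\<close> D r by simp
  then have "\<theta> * sqrt (4 * R\<^sup>2 * D * l) = 2 * (D * ((R * \<theta>) * r))"
    by simp
  also have "\<dots> = 2 * l"
    unfolding R\<theta> rD[symmetric] by (simp add: power2_eq_square)
  finally show ?thesis using first by linarith
qed

theorem proposition3p1: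
  fixes T :: "nat pair_pre_digraph set"
    and p :: "nat \<Rightarrow> nat pair_pre_digraph \<Rightarrow> nat list \<Rightarrow> real"
    and P :: "nat \<Rightarrow> 'a measure"
    and X :: "nat \<Rightarrow> nat pair_pre_digraph \<Rightarrow> nat list \<Rightarrow> 'a \<Rightarrow> bool"
    and \<epsilon> :: real
  defines "A\<^sub>w \<equiv> \<lambda>n. wSUGM_adj n T (X n)"
    and "EA\<^sub>w \<equiv> \<lambda>n. expected_mat (P n) n (wSUGM_adj n T (X n))"
    and "\<Delta>\<^sub>w \<equiv> \<lambda>n. mat_norm_inf (expected_mat (P n) n (wSUGM_adj n T (X n)))"
    and "M \<equiv> Max (type_size ` T)"
  assumes "finite T" and "T \<noteq> {}" and "\<And>t. t \<in> T \<Longrightarrow> subgraph_type t"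
    and "\<And>n. wSUGM (P n) n T (p n) (X n)"
    and "\<epsilon> > 0"
    and "\<forall>\<^sub>F n in sequentially. \<Delta>\<^sub>w n > 4 / 9 * ln (2 * real n / \<epsilon>)"
  shows "\<forall>\<^sub>F n in sequentially.
    measure (P n) {\<omega> \<in> space (P n).
      spectral_norm (A\<^sub>w n \<omega> - EA\<^sub>w n)
        \<le> sqrt (4 * (real M)\<^sup>2 * \<Delta>\<^sub>w n * ln (2 * real n / \<epsilon>))}
    \<ge> 1 - \<epsilon>"
proof -
  obtain t where "t \<in> T" using \<open>T \<noteq> {}\<close> by auto
  then have "type_size t \<le> M" using \<open>finite T\<close> by (simp add: M_def)
  then have M: "2 \<le> real M"
    using subgraph_type_size_ge_2[OF assms(7)[OF \<open>t \<in> T\<close>]] by simp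
  \<comment> \<open>This makes \<open>2 * real n / \<epsilon>\<close> exceed 1, so the logarithm is
    positive, and it also forces \<open>0 < n\<close>.\<close>
  have "\<forall>\<^sub>F n in sequentially. \<epsilon> < real n"
    using filterlim_real_sequentially by (simp add: filterlim_at_top_dense)
  with \<open>\<forall>\<^sub>F n in sequentially. \<Delta>\<^sub>w n > 4 / 9 * ln (2 * real n / \<epsilon>)\<close> show ?thesis
  proof eventually_elim
    case (elim n)
    interpret wSUGM "P n" n T "p n" "X n" by (rule assms(8))
    define l where "l = ln (2 * real n / \<epsilon>)"
    define \<theta> where "\<theta> = sqrt (l / \<Delta>\<^sub>w n) / real M"
    let ?t = "sqrt (4 * (real M)\<^sup>2 * \<Delta>\<^sub>w n * l)"
    have "0 < real n" using elim \<open>\<epsilon> > 0\<close> by linarith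
    then have "0 < n" by simp
    have l: "0 < l" unfolding l_def using elim \<open>\<epsilon> > 0\<close> by (intro ln_gt_zero) simp
    have \<Delta>: "4 / 9 * l < \<Delta>\<^sub>w n" using elim by (simp add: l_def)
    then have "0 < \<Delta>\<^sub>w n" using l by linarith
    have "0 \<le> \<theta>" "0 \<le> ?t" using l \<open>0 < \<Delta>\<^sub>w n\<close> by (auto simp: \<theta>_def)
    \<comment> \<open>The level \<open>l\<close> is the logarithm of
      \<open>2 * real n / \<epsilon>\<close>, so the dimension factor is cancelled and exactly
      \<open>\<epsilon>\<close> remains.\<close>
    have "2 * real n * exp (\<Delta>\<^sub>w n / real M * (exp (real M * \<theta>) - 1 - real M * \<theta>) - \<theta> * ?t)
        \<le> 2 * real n * exp (- l)"
      unfolding \<theta>_def using bennett_exponent_le[OF M l \<Delta>] by (intro mult_left_mono) auto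
    also have "\<dots> = \<epsilon>"
      using \<open>\<epsilon> > 0\<close> \<open>0 < n\<close> by (simp add: l_def exp_minus)
    finally have "1 - \<epsilon> \<le> 1 - 2 * real n
        * exp (\<Delta>\<^sub>w n / real M * (exp (real M * \<theta>) - 1 - real M * \<theta>) - \<theta> * ?t)"
      by simp
    also have "\<dots> \<le> measure (P n) {\<omega> \<in> space (P n). spectral_norm (A\<^sub>w n \<omega> - EA\<^sub>w n) \<le> ?t}"
      unfolding A\<^sub>w_def EA\<^sub>w_def \<Delta>\<^sub>w_def M_def
      using assms(5-7) \<open>0 < n\<close> \<open>0 \<le> \<theta>\<close> \<open>0 \<le> ?t\<close>
      by (intro spectral_norm_deviation_tail) (auto simp: \<Delta>\<^sub>w_def M_def)
    finally show ?case by (simp add: l_def)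
  qed
qed

end
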